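(* Let $k\ge 1$ be an integer and let $G$ be a graph of order $n$. Then $L_k(G)=k$ if and only if one of the following conditions holds: (i) $n=k$; (ii) $n=k+1$ and $\Delta(G)=k$; (iii) $n\geq k+2$ and for each $(k+1)$-subset $X$ of $V(G)$, either the induced subgraph $G[X]$ has maximum degree $k$, or the $k+1$ vertices of $X$ have a common neighbour in $G$.
   Context: All graphs are finite, undirected, simple and nontrivial (at least two vertices). $\Delta(G)$ is the maximum degree and $N[v]=\{v\}\cup N(v)$ is the closed neighbourhood of $v$. For an integer $k\ge 1$, a set $B\subseteq V(G)$ is a $k$-limited packing if $|N[v]\cap B|\le k$ for every vertex $v$ of $G$; $L_k(G)$ is the maximum cardinality of a $k$-limited packing in $G$. *)

theory Defs
  imports "Graph_Theory.Digraph_Component"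
begin

text \<open>
  A finite simple undirected graph is an instance of the locale \<^locale>\<open>graph\<close>: a finite
  loop-free digraph without parallel arcs whose adjacency relation is symmetric. An undirected
  edge is a pair of opposite arcs, so the degree of a vertex is its out-degree.
\<close>

definition neighbourhood :: "('a, 'b) pre_digraph \<Rightarrow> 'a \<Rightarrow> 'a set" where
  "neighbourhood G v = {u \<in> verts G. v \<rightarrow>\<^bsub>G\<^esub> u}"

definition closed_neighbourhood :: "('a, 'b) pre_digraph \<Rightarrow> 'a \<Rightarrow> 'a set" where
  "closed_neighbourhood G v = {v} \<union> neighbourhood G v"

text \<open>Meaningful only for a finite nonempty vertex set, as \<^const>\<open>Max\<close> is unspecified otherwise.\<close>

definition max_degree :: "('a, 'b) pre_digraph \<Rightarrow> nat" where
  "max_degree G = Max (out_degree G ` verts G)"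

definition limited_packing :: "nat \<Rightarrow> ('a, 'b) pre_digraph \<Rightarrow> 'a set \<Rightarrow> bool" where
  "limited_packing k G B \<longleftrightarrow>
    B \<subseteq> verts G \<and> (\<forall>v \<in> verts G. card (closed_neighbourhood G v \<inter> B) \<le> k)"

text \<open>For finite \<open>G\<close> the maximum is over a finite set, nonempty since \<open>{}\<close> is a packing.\<close>

definition limited_packing_number :: "nat \<Rightarrow> ('a, 'b) pre_digraph \<Rightarrow> nat" where
  "limited_packing_number k G = Max (card ` {B. limited_packing k G B})"

definition have_common_neighbour :: "('a, 'b) pre_digraph \<Rightarrow> 'a set \<Rightarrow> bool" where
  "have_common_neighbour G X \<longleftrightarrow> (\<exists>v \<in> verts G. \<forall>x \<in> X. v \<in> neighbourhood G x)"

end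

theory Submission
  imports Defs
begin

text \<open>
  Packings are closed under subsets and every set of at most \<open>k\<close> vertices is a packing, so
  \<open>L\<^sub>k(G) = k\<close> means that \<open>n \<ge> k\<close> and that every \<open>(k + 1)\<close>-set \<open>X\<close> lies in some closed
  neighbourhood \<open>N[v]\<close>. If \<open>v \<in> X\<close>, then \<open>v\<close> has degree \<open>k\<close> in \<open>G[X]\<close>; otherwise \<open>v\<close> is a common
  neighbour of \<open>X\<close>.
\<close>

text \<open>Without parallel arcs, distinct arcs out of \<open>v\<close> have distinct heads, so
  \<open>head G\<close> matches them with the neighbours of \<open>v\<close>. This lets degrees,
  which count arcs, be compared with cardinalities of vertex sets.\<close>

lemma (in nomulti_digraph) out_degree_eq_card_neighbourhood:
  "out_degree G v = card (neighbourhood G v)"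
proof -
  have "inj_on (head G) (out_arcs G v)"
    by (rule inj_onI) (auto simp: arc_to_ends_def intro: no_multi_arcs)
  moreover have "head G ` out_arcs G v = neighbourhood G v"
    by (force simp: neighbourhood_def arcs_ends_def arc_to_ends_def)
  ultimately show ?thesis
    unfolding out_degree_def by (metis card_image)
qed

lemma (in wf_digraph) induce_subgraph_verts_eq: "G \<restriction> verts G = G"
  by (rule pre_digraph.equality) (auto simp: induce_subgraph_def)

lemma neighbourhood_induce_subgraph:
  assumes "X \<subseteq> verts G" "v \<in> X"
  shows "neighbourhood (G \<restriction> X) v = neighbourhood G v \<inter> X"
  using assms by (auto simp: neighbourhood_def arcs_ends_def arc_to_ends_def)

lemma (in loopfree_digraph) not_in_neighbourhood: "v \<notin> neighbourhood G v"
  using adj_not_same by (auto simp: neighbourhood_def)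

text \<open>Without loops, a vertex \<open>v\<close> of \<open>X\<close> has its neighbours in
  \<open>X\<close> among the \<open>k\<close> vertices of \<open>X - {v}\<close>. So
  \<open>k\<close> bounds all degrees in \<open>G \<restriction> X\<close>, and it is reached
  exactly when \<open>v\<close> is adjacent to all the rest of \<open>X\<close>.\<close>

lemma (in digraph) max_degree_induce_subgraph_eq_iff:
  assumes "X \<subseteq> verts G" and "card X = k + 1"
  shows "max_degree (G \<restriction> X) = k \<longleftrightarrow> (\<exists>v \<in> X. X \<subseteq> closed_neighbourhood G v)"
proof -
  have fin: "finite X"
    using assms finite_verts finite_subset by blast
  interpret H: digraph "G \<restriction> X"
    using assms(1) by (intro digraphI_induced induced_induce)
  have card_diff: "card (X - {v}) = k" if "v \<in> X" for v
    using that fin assms(2) by simp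
  have sub: "neighbourhood G v \<inter> X \<subseteq> X - {v}" for v
    using not_in_neighbourhood by auto
  have deg: "out_degree (G \<restriction> X) v = card (neighbourhood G v \<inter> X)" if "v \<in> X" for v
    using that assms(1) H.out_degree_eq_card_neighbourhood neighbourhood_induce_subgraph
    by metis
  have le: "out_degree (G \<restriction> X) v \<le> k" if "v \<in> X" for v
    using deg[OF that] card_diff[OF that] card_mono[OF _ sub] fin by (metis finite_Diff)
  have eq: "out_degree (G \<restriction> X) v = k \<longleftrightarrow> X \<subseteq> closed_neighbourhood G v" if "v \<in> X" for v
  proof -
    have "out_degree (G \<restriction> X) v = k \<longleftrightarrow> neighbourhood G v \<inter> X = X - {v}"
      using deg[OF that] card_diff[OF that] card_subset_eq[OF _ sub] fin by (metis finite_Diff)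
    also have "\<dots> \<longleftrightarrow> X \<subseteq> closed_neighbourhood G v"
      using sub by (auto simp: closed_neighbourhood_def)
    finally show ?thesis .
  qed
  have "X \<noteq> {}"
    using assms(2) by auto
  then have "max_degree (G \<restriction> X) = k \<longleftrightarrow> (\<exists>v \<in> X. out_degree (G \<restriction> X) v = k)"
    unfolding max_degree_def using fin le by (subst Max_eq_iff) auto
  with eq show ?thesis
    by auto
qed

text \<open>As no vertex is its own neighbour, a common neighbour of \<open>X\<close> lies outside
  \<open>X\<close>. For such a vertex, open and closed neighbourhoods contain the same vertices of
  \<open>X\<close>, and symmetry of adjacency swaps the roles of \<open>v\<close> and
  \<open>x\<close>.\<close>

lemma (in graph) have_common_neighbour_iff:
  assumes "X \<subseteq> verts G"
  shows "have_common_neighbour G X \<longleftrightarrow>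
    (\<exists>v \<in> verts G - X. X \<subseteq> closed_neighbourhood G v)"
proof -
  have "v \<in> neighbourhood G x \<longleftrightarrow> x \<in> neighbourhood G v" if "x \<in> verts G" "v \<in> verts G" for x v
    using that graph_symmetric unfolding neighbourhood_def by auto
  then show ?thesis
    using assms not_in_neighbourhood unfolding have_common_neighbour_def closed_neighbourhood_def
    by blast
qed

lemma limited_packing_subset:
  assumes "limited_packing k G B" "C \<subseteq> B" "finite (verts G)"
  shows "limited_packing k G C"
proof -
  have "finite B"
    using assms finite_subset unfolding limited_packing_def by blast
  then have "card (closed_neighbourhood G v \<inter> C) \<le> card (closed_neighbourhood G v \<inter> B)" for v
    using assms(2) by (intro card_mono) auto
  then show ?thesis
    using assms unfolding limited_packing_def by (meson order_trans)
qed

lemma limited_packing_if_card_le: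
  assumes "B \<subseteq> verts G" "finite (verts G)" "card B \<le> k"
  shows "limited_packing k G B"
  using assms card_mono[of B] finite_subset unfolding limited_packing_def
  by (metis Int_lower2 order_trans)

lemma limited_packing_Suc_iff:
  assumes "X \<subseteq> verts G" "finite (verts G)" "card X = k + 1"
  shows "limited_packing k G X \<longleftrightarrow> \<not> (\<exists>v \<in> verts G. X \<subseteq> closed_neighbourhood G v)"
proof -
  have fin: "finite X"
    using assms finite_subset by blast
  have "card (closed_neighbourhood G v \<inter> X) \<le> k \<longleftrightarrow> \<not> X \<subseteq> closed_neighbourhood G v" for v
  proof
    assume "card (closed_neighbourhood G v \<inter> X) \<le> k"
    then show "\<not> X \<subseteq> closed_neighbourhood G v"
      using assms(3) by (auto simp: Int_absorb1)
  next
    assume "\<not> X \<subseteq> closed_neighbourhood G v"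
    then have "closed_neighbourhood G v \<inter> X \<subset> X"
      by auto
    from psubset_card_mono[OF fin this] show "card (closed_neighbourhood G v \<inter> X) \<le> k"
      using assms(3) by simp
  qed
  then show ?thesis
    using assms(1) unfolding limited_packing_def by auto
qed

lemma limited_packing_number_eq_iff:
  assumes "finite (verts G)"
  shows "limited_packing_number k G = k \<longleftrightarrow>
    k \<le> card (verts G) \<and> (\<forall>X. X \<subseteq> verts G \<and> card X = k + 1 \<longrightarrow> \<not> limited_packing k G X)"
proof -
  let ?S = "card ` {B. limited_packing k G B}"
  have "{B. limited_packing k G B} \<subseteq> Pow (verts G)"
    by (auto simp: limited_packing_def)
  then have fin: "finite ?S"
    using assms by (meson finite_Pow_iff finite_imageI finite_subset)
  \<comment> \<open>The empty packing makes \<open>?S\<close> nonempty, as the characterisation of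
    \<open>Max\<close> requires.\<close>
  have "limited_packing k G {}"
    by (simp add: limited_packing_def)
  then have "?S \<noteq> {}"
    by auto
  then have "limited_packing_number k G = k \<longleftrightarrow> k \<in> ?S \<and> (\<forall>s \<in> ?S. s \<le> k)"
    unfolding limited_packing_number_def by (subst Max_eq_iff[OF fin]) auto
  also have "k \<in> ?S \<longleftrightarrow> k \<le> card (verts G)"
  proof
    assume "k \<in> ?S"
    then show "k \<le> card (verts G)"
      using assms by (auto simp: limited_packing_def card_mono)
  next
    assume "k \<le> card (verts G)"
    then obtain B where "B \<subseteq> verts G" "card B = k"
      using obtain_subset_with_card_n by metis
    then show "k \<in> ?S"
      using limited_packing_if_card_le[OF _ assms] by force
  qed
  also have "(\<forall>s \<in> ?S. s \<le> k) \<longleftrightarrow>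
    (\<forall>X. X \<subseteq> verts G \<and> card X = k + 1 \<longrightarrow> \<not> limited_packing k G X)"
  proof
    assume "\<forall>s \<in> ?S. s \<le> k"
    then show "\<forall>X. X \<subseteq> verts G \<and> card X = k + 1 \<longrightarrow> \<not> limited_packing k G X"
      by auto
  next
    assume none: "\<forall>X. X \<subseteq> verts G \<and> card X = k + 1 \<longrightarrow> \<not> limited_packing k G X"
    have "card B \<le> k" if "limited_packing k G B" for B
    proof (rule ccontr)
      assume "\<not> card B \<le> k"
      \<comment> \<open>A packing that is too large is cut down to exactly \<open>k + 1\<close>
        vertices and remains a packing, so only sets of that size need checking.\<close>
      then obtain X where "X \<subseteq> B" "card X = k + 1"
        using obtain_subset_with_card_n[of "k + 1" B] by auto
      moreover have "X \<subseteq> verts G"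
        using \<open>X \<subseteq> B\<close> that by (auto simp: limited_packing_def)
      ultimately show False
        using none limited_packing_subset[OF that _ assms] by blast
    qed
    then show "\<forall>s \<in> ?S. s \<le> k"
      by auto
  qed
  finally show ?thesis .
qed

theorem theorem3p4:
  fixes G :: "('a, 'b) pre_digraph" and k n :: nat
  assumes "graph G"
    and "card (verts G) \<ge> 2"
    and "k \<ge> 1"
    and "n = card (verts G)"
  shows "limited_packing_number k G = k \<longleftrightarrow>
    n = k \<or>
    (n = k + 1 \<and> max_degree G = k) \<or>
    (n \<ge> k + 2 \<and>
      (\<forall>X. X \<subseteq> verts G \<and> card X = k + 1 \<longrightarrow>
        max_degree (G \<restriction> X) = k \<or> have_common_neighbour G X))"
proof -
  interpret graph G by fact
  let ?P = "\<lambda>X. max_degree (G \<restriction> X) = k \<or> have_common_neighbour G X"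
  \<comment> \<open>The centre of a closed neighbourhood containing \<open>X\<close> lies either in
    \<open>X\<close> or in \<open>verts G - X\<close>; these cases give the two disjuncts of
    \<open>?P\<close>.\<close>
  have "\<not> limited_packing k G X \<longleftrightarrow> ?P X" if "X \<subseteq> verts G" "card X = k + 1" for X
    using that max_degree_induce_subgraph_eq_iff[OF that] have_common_neighbour_iff[OF that(1)]
      limited_packing_Suc_iff[OF that(1) finite_verts that(2)]
    by blast
  then have main: "limited_packing_number k G = k \<longleftrightarrow>
      k \<le> n \<and> (\<forall>X. X \<subseteq> verts G \<and> card X = k + 1 \<longrightarrow> ?P X)"
    using limited_packing_number_eq_iff[OF finite_verts] assms(4) by metis
  consider "n < k" | "n = k" | "n = k + 1" | "n \<ge> k + 2"
    by linarith
  then show ?thesis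
  proof cases
    case 1
    then show ?thesis using main by auto
  next
    case 2
    \<comment> \<open>No set of \<open>k + 1\<close> vertices exists, so the condition in
      \<open>main\<close> is vacuous.\<close>
    then have "card X \<noteq> k + 1" if "X \<subseteq> verts G" for X
      using card_mono[OF finite_verts that] assms(4) by simp
    then show ?thesis using main 2 by auto
  next
    case 3
    then have "X = verts G" if "X \<subseteq> verts G" "card X = k + 1" for X
      using that assms(4) by (simp add: card_subset_eq)
    then have "(\<forall>X. X \<subseteq> verts G \<and> card X = k + 1 \<longrightarrow> ?P X) \<longleftrightarrow> ?P (verts G)"
      using 3 assms(4) by auto
    \<comment> \<open>The only set to test is \<open>verts G\<close>, and no vertex is left outside
      it to be a common neighbour; only the degree condition survives.\<close>
    moreover have "\<not> have_common_neighbour G (verts G)"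
      by (simp add: have_common_neighbour_iff)
    moreover have "max_degree (G \<restriction> verts G) = max_degree G"
      by (simp add: induce_subgraph_verts_eq)
    ultimately show ?thesis using main 3 by simp
  next
    case 4
    then show ?thesis using main by simp
  qed
qed

end
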